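(* Suppose that the function $\varphi:[0,\infty)\to\mathbb{R}$ is completely monotone with $\varphi(0)=1$ and not constant. Then the restriction $\psi=\varphi|_{[0,\pi]}$ of $\varphi$ to the interval $[0,\pi]$ belongs to the class $\Psi_\infty^+$.
   Context: A function $\varphi:[0,\infty)\to\mathbb{R}$ is completely monotone if it possesses derivatives $\varphi^{(k)}$ of all orders with $(-1)^k\varphi^{(k)}(t)\ge 0$ for all integers $k\ge 0$ and all $t>0$. Let $\mathbb{S}^d=\{x\in\mathbb{R}^{d+1}:\|x\|=1\}$ and let $\theta(x,y)=\arccos(\langle x,y\rangle)\in[0,\pi]$ be the great circle distance on $\mathbb{S}^d$. A function $h:\mathbb{S}^d\times\mathbb{S}^d\to\mathbb{R}$ is strictly positive definite if $\sum_{i=1}^n\sum_{j=1}^n c_i c_j h(x_i,x_j)\ge 0$ for all finite systems of pairwise distinct points $x_1,\ldots,x_n\in\mathbb{S}^d$ and all $c_1,\ldots,c_n\in\mathbb{R}$, with strict inequality unless $c_1=\cdots=c_n=0$. For an integer $d\ge 1$, the class $\Psi_d^+$ consists of the continuous functions $\psi:[0,\pi]\to\mathbb{R}$ with $\psi(0)=1$ such that $h(x,y)=\psi(\theta(x,y))$ is strictly positive definite on $\mathbb{S}^d$. Set $\Psi_\infty^+=\bigcap_{d=1}^\infty\Psi_d^+$.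
   Formalization: Continuity of φ at 0 is made part of complete monotonicity; with derivatives required only for t>0 the claim fails, e.g. for φ(0)=1, φ(t)=e^{-t}/2 for t>0, whose restriction is not continuous. *)

theory Defs
  imports "HOL-Analysis.Analysis"
begin

text \<open>
  A function on \<open>[0,\<infinity>)\<close> is represented by a function on all reals; only its values on \<open>{0..}\<close>
  matter, since the derivatives are taken at interior points \<open>t > 0\<close>.
  The derivative conditions constrain only \<open>t > 0\<close>, so they say nothing about the endpoint value;
  as usual for complete monotonicity on the closed half-line, continuity on \<open>[0,\<infinity>)\<close> is part of
  the notion. (Otherwise the function with value 1 at 0 and 1/2 elsewhere would qualify.)
  No derivative at 0 is required, so that for instance \<open>exp (- sqrt t)\<close> is included.
\<close>

definition completely_monotone :: "(real \<Rightarrow> real) \<Rightarrow> bool" where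
  "completely_monotone \<phi> \<longleftrightarrow>
     continuous_on {0..} \<phi> \<and>
     (\<forall>k. \<forall>t>0. ((deriv ^^ k) \<phi>) differentiable (at t) \<and> (-1) ^ k * (deriv ^^ k) \<phi> t \<ge> 0)"

text \<open>
  The dimension is quantified inside a formula below, so the unit sphere is the carrier of the
  library's \<open>nsphere d\<close>: points of \<open>\<real>\<^sup>d\<^sup>+\<^sup>1\<close> are sequences supported on the
  indices \<open>0, \<dots>, d\<close>.
\<close>

abbreviation unit_sphere :: "nat \<Rightarrow> (nat \<Rightarrow> real) set" where
  "unit_sphere d \<equiv> topspace (nsphere d)"

lemma mem_unit_sphere_iff:
  "x \<in> unit_sphere d \<longleftrightarrow> (\<Sum>i\<le>d. (x i)\<^sup>2) = 1 \<and> (\<forall>i>d. x i = 0)"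
  by (simp add: nsphere)

definition great_circle_dist :: "nat \<Rightarrow> (nat \<Rightarrow> real) \<Rightarrow> (nat \<Rightarrow> real) \<Rightarrow> real" where
  "great_circle_dist d x y = arccos (\<Sum>i\<le>d. x i * y i)"

definition strictly_positive_definite_on :: "'a set \<Rightarrow> ('a \<Rightarrow> 'a \<Rightarrow> real) \<Rightarrow> bool" where
  "strictly_positive_definite_on S h \<longleftrightarrow>
     (\<forall>(n::nat) (x :: nat \<Rightarrow> 'a) (c :: nat \<Rightarrow> real).
        x ` {1..n} \<subseteq> S \<longrightarrow> inj_on x {1..n} \<longrightarrow>
          (\<Sum>i=1..n. \<Sum>j=1..n. c i * c j * h (x i) (x j)) \<ge> 0 \<and>
          ((\<exists>i\<in>{1..n}. c i \<noteq> 0) \<longrightarrow>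
             (\<Sum>i=1..n. \<Sum>j=1..n. c i * c j * h (x i) (x j)) > 0))"

text \<open>
  Functions with domain exactly \<open>[0,\<pi>]\<close> are the members of \<open>extensional {0..pi}\<close>.
\<close>

definition Psi_plus :: "nat \<Rightarrow> (real \<Rightarrow> real) set" where
  "Psi_plus d =
     {\<psi> \<in> extensional {0..pi}.
        continuous_on {0..pi} \<psi> \<and> \<psi> 0 = 1 \<and>
        strictly_positive_definite_on (unit_sphere d) (\<lambda>x y. \<psi> (great_circle_dist d x y))}"

definition Psi_plus_infinity :: "(real \<Rightarrow> real) set" where
  "Psi_plus_infinity = (\<Inter>d\<in>{1..}. Psi_plus d)"

end

theory Submission
  imports Defs
begin

text \<open>
  Since \<open>\<theta> = \<pi>/2 - arcsin \<langle>x, y\<rangle>\<close>, the kernel is \<open>F (arcsin \<langle>x, y\<rangle>)\<close> with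
  \<open>F u = \<phi> (\<pi>/2 - u)\<close> absolutely monotone on \<open>u < \<pi>/2\<close>. By Bernstein's theorem on absolutely
  monotone functions \<open>F\<close> is the sum of its Taylor series at 0 for \<open>|u| < \<pi>/2\<close>, with nonnegative
  coefficients; those of \<open>u\<close> and \<open>u\<^sup>2\<close> are positive because \<open>F\<close> is bounded below on a half-line and not
  constant. The arcsine has nonnegative Taylor coefficients too, the odd ones being positive, so
  all powers \<open>arcsin \<langle>x, y\<rangle>\<^sup>m\<close> are positive semidefinite. If the quadratic form of the kernel
  vanishes, so do those of \<open>arcsin \<langle>x, y\<rangle>\<close> and its square, hence those of \<open>\<langle>x, y\<rangle>\<^sup>n\<close> for every
  \<open>n \<ge> 1\<close>, and letting \<open>n \<rightarrow> \<infinity>\<close> along both parities isolates \<open>\<Sum> c\<^sub>i\<^sup>2\<close>. Boundary arguments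
  \<open>\<langle>x, y\<rangle> = \<plusminus>1\<close> are reached by scaling with \<open>t < 1\<close> and continuity.
\<close>

section \<open>Absolutely monotone functions\<close>

text \<open>The derivatives form an explicit sequence \<open>D\<close>, as in the Maclaurin theorems
  of the library. The domain is unbounded to the left, which \<open>deriv_0_pos\<close>
  exploits.\<close>

locale absolutely_monotone_below =
  fixes D :: "nat \<Rightarrow> real \<Rightarrow> real" and b :: real
  assumes b_pos: "0 < b"
    and deriv: "u < b \<Longrightarrow> (D k has_real_derivative D (Suc k) u) (at u)"
    and nonneg: "u < b \<Longrightarrow> 0 \<le> D k u"
begin

lemma mono: "u \<le> v \<Longrightarrow> v < b \<Longrightarrow> D k u \<le> D k v"
  by (rule DERIV_nonneg_imp_nondecreasing[of u v "D k"]) (auto intro!: deriv nonneg exI)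

text \<open>The Lagrange remainder is nonnegative because every derivative is.\<close>

lemma taylor_le:
  assumes "0 < v" "v < b"
  shows "(\<Sum>m<n. D m 0 / fact m * v ^ m) \<le> D 0 v"
proof -
  have "\<exists>t. 0 < t \<and> t \<le> v \<and> D 0 v = (\<Sum>m<n. D m 0 / fact m * v ^ m) + D n t / fact n * v ^ n"
    by (rule Maclaurin2) (use assms in \<open>auto intro: deriv\<close>)
  then obtain t where "t \<le> v"
    and eq: "D 0 v = (\<Sum>m<n. D m 0 / fact m * v ^ m) + D n t / fact n * v ^ n" by blast
  have "0 \<le> D n t / fact n * v ^ n"
    using assms \<open>t \<le> v\<close> by (intro mult_nonneg_nonneg divide_nonneg_nonneg nonneg) auto
  with eq show ?thesis by simp
qed

lemma term_le:
  assumes "0 < v" "v < b"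
  shows "D n 0 / fact n * v ^ n \<le> D 0 v"
proof -
  have "0 \<le> (\<Sum>m<n. D m 0 / fact m * v ^ m)"
    using assms by (intro sum_nonneg mult_nonneg_nonneg divide_nonneg_nonneg nonneg) auto
  with taylor_le[OF assms, of "Suc n"] show ?thesis by simp
qed

text \<open>
  Bernstein's remainder estimate: comparing \<open>\<lambda>\<^sup>n F(v)\<close> with \<open>F(\<lambda>v)\<close>, the \<open>n\<close>-th derivative of
  the difference is \<open>\<lambda>\<^sup>n (F\<^sup>(\<^sup>n\<^sup>)(v) - F\<^sup>(\<^sup>n\<^sup>)(\<lambda>v)) \<ge> 0\<close>.
\<close>
lemma remainder_le:
  assumes v: "0 < v" "v < b" and l: "0 < l" "l < 1"
  shows "D 0 (l * v) - (\<Sum>m<n. D m 0 / fact m * (l * v) ^ m) \<le> l ^ n * D 0 v"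
proof -
  define G where "G k x = l ^ n * D k x - l ^ k * D k (l * x)" for k x
  have lx: "l * x \<le> x" if "0 \<le> x" for x
    using that l by (simp add: mult_left_le_one_le)
  have "\<exists>t. 0 < t \<and> t \<le> v \<and> G 0 v = (\<Sum>m<n. G m 0 / fact m * v ^ m) + G n t / fact n * v ^ n"
  proof (rule Maclaurin2)
    show "\<forall>m t. m < n \<and> 0 \<le> t \<and> t \<le> v \<longrightarrow> DERIV (G m) t :> G (Suc m) t"
    proof (intro allI impI)
      fix m t assume a: "m < n \<and> 0 \<le> t \<and> t \<le> v"
      with lx[of t] v have t: "t < b" "l * t < b" by auto
      have "((\<lambda>x. D m (l * x)) has_real_derivative D (Suc m) (l * t) * l) (at t)"
        by (rule DERIV_chain2[OF deriv]) (use t in \<open>auto intro!: derivative_eq_intros\<close>)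
      from DERIV_diff[OF DERIV_cmult[OF deriv[OF t(1), of m], of "l ^ n"]
          DERIV_cmult[OF this, of "l ^ m"]]
      show "DERIV (G m) t :> G (Suc m) t"
        by (simp add: G_def[abs_def] mult_ac)
    qed
  qed (use v in auto)
  then obtain t where t: "0 < t" "t \<le> v"
    and eq: "G 0 v = (\<Sum>m<n. G m 0 / fact m * v ^ m) + G n t / fact n * v ^ n" by blast
  have "D n (l * t) \<le> D n t"
    by (rule mono) (use t v lx[of t] in auto)
  then have "0 \<le> G n t" using l by (simp add: G_def)
  then have "0 \<le> G n t / fact n * v ^ n" using v by simp
  \<comment> \<open>Here \<open>G m 0 = (l ^ n - l ^ m) * D m 0\<close>; dropping the nonnegative
    \<open>l ^ n\<close> part leaves minus the Taylor polynomial at \<open>l * v\<close>.\<close>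
  moreover have "(\<Sum>m<n. G m 0 / fact m * v ^ m)
      \<ge> - (\<Sum>m<n. D m 0 / fact m * (l * v) ^ m)"
    unfolding sum_negf[symmetric]
  proof (rule sum_mono)
    fix m
    have "0 \<le> l ^ n * D m 0 / fact m * v ^ m"
      using v l b_pos by (intro mult_nonneg_nonneg divide_nonneg_nonneg nonneg) auto
    then show "- (D m 0 / fact m * (l * v) ^ m) \<le> G m 0 / fact m * v ^ m"
      by (simp add: G_def power_mult_distrib field_simps)
  qed
  ultimately have "G 0 v \<ge> - (\<Sum>m<n. D m 0 / fact m * (l * v) ^ m)"
    using eq by linarith
  then show ?thesis by (simp add: G_def)
qed

text \<open>With \<open>v\<close> strictly between \<open>\<bar>u\<bar>\<close> and
  \<open>b\<close>, the remainder decays like \<open>(\<bar>u\<bar> / v) ^ n\<close>. For positive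
  \<open>u\<close> this is \<open>remainder_le\<close>; for negative \<open>u\<close> the derivative
  in the Lagrange remainder is at most \<open>D n 0\<close> by monotonicity, and
  \<open>term_le\<close> bounds that.\<close>

lemma power_series:
  assumes u: "\<bar>u\<bar> < b"
  shows "(\<lambda>n. D n 0 / fact n * u ^ n) sums D 0 u"
proof -
  obtain v where v: "\<bar>u\<bar> < v" "v < b" using dense[OF u] by blast
  then have v0: "0 < v" by linarith
  define l where "l = \<bar>u\<bar> / v"
  have l: "0 \<le> l" "l < 1" using v v0 by (auto simp: l_def)
  have bound: "\<bar>D 0 u - (\<Sum>m<n. D m 0 / fact m * u ^ m)\<bar> \<le> l ^ n * D 0 v" if n: "0 < n" for n
  proof -
    consider "u = 0" | "0 < u" | "u < 0" by linarith
    then show ?thesis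
    proof cases
      case 1
      with n have "(\<Sum>m<n. D m 0 / fact m * u ^ m) = D 0 0"
        using Maclaurin_zero[of u n D] by simp
      with 1 n show ?thesis using nonneg[of v 0] v l by simp
    next
      case 2
      then have lv: "l * v = u" and "0 < l" using v0 by (auto simp: l_def)
      with remainder_le[OF v0 v(2) _ l(2), of n] taylor_le[OF 2, of n] u show ?thesis by simp
    next
      case 3
      have "\<exists>t. u < t \<and> t < 0 \<and>
          D 0 u = (\<Sum>m<n. D m 0 / fact m * u ^ m) + D n t / fact n * u ^ n"
        by (rule Maclaurin_minus) (use 3 n b_pos in \<open>auto intro!: deriv\<close>)
      then obtain t where t: "t < 0"
        and eq: "D 0 u = (\<Sum>m<n. D m 0 / fact m * u ^ m) + D n t / fact n * u ^ n" by blast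
      have "\<bar>D 0 u - (\<Sum>m<n. D m 0 / fact m * u ^ m)\<bar> = D n t / fact n * \<bar>u\<bar> ^ n"
        using eq nonneg[of t n] t b_pos by (simp add: abs_mult power_abs)
      also have "\<dots> \<le> D n 0 / fact n * \<bar>u\<bar> ^ n"
        using mono[of t 0 n] t b_pos by (intro mult_right_mono divide_right_mono) auto
      also have "\<dots> = l ^ n * (D n 0 / fact n * v ^ n)"
        using v0 by (simp add: l_def power_divide)
      also have "\<dots> \<le> l ^ n * D 0 v"
        using term_le[OF v0 v(2)] l by (intro mult_left_mono) auto
      finally show ?thesis .
    qed
  qed
  have "(\<lambda>n. l ^ n * D 0 v) \<longlonglongrightarrow> 0"
    using l by (intro tendsto_mult_left_zero LIMSEQ_realpow_zero) auto
  then have "(\<lambda>n. D 0 u - (\<Sum>m<n. D m 0 / fact m * u ^ m)) \<longlonglongrightarrow> 0"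
    by (rule Lim_null_comparison[rotated])
      (use bound in \<open>auto intro!: eventually_sequentiallyI[of 1]\<close>)
  from tendsto_diff[OF tendsto_const[of "D 0 u"] this] show ?thesis
    by (simp add: sums_def)
qed

lemma deriv_0_pos:
  assumes nonconst: "\<not> (\<forall>u<b. D 0 u = D 0 0)"
  shows "0 < D 1 0" and "0 < D 2 0"
proof -
  show D1: "0 < D 1 0"
  proof (rule ccontr)
    assume "\<not> 0 < D 1 0"
    with nonneg[of 0 1] b_pos have z: "D 1 0 = 0" by simp
    text \<open>A zero of a nonnegative function is a minimum, hence a zero of its derivative.\<close>
    have zero: "D (Suc k) 0 = 0" for k
    proof (induction k)
      case (Suc k)
      show ?case
        by (rule DERIV_local_min[OF deriv b_pos])
          (use Suc b_pos in \<open>auto intro!: nonneg\<close>)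
    qed (use z in simp)
    have "D 0 u = D 0 0" if "u < b" for u
    proof (cases "u < 0")
      case True
      obtain t where t: "u < t" "t < 0" "D 0 0 - D 0 u = (0 - u) * D 1 t"
        using MVT2[OF True, of "D 0" "D 1"] deriv b_pos by (metis One_nat_def le_less_trans)
      have "D 1 t \<le> D 1 0" "0 \<le> D 1 t" using t b_pos by (auto intro: mono nonneg)
      with z t show ?thesis by simp
    next
      case False
      have "D 0 u = (\<Sum>n. D n 0 / fact n * u ^ n)"
        using power_series[of u] that False by (simp add: sums_iff)
      also have "\<dots> = (\<Sum>n\<in>{0}. D n 0 / fact n * u ^ n)"
        by (rule suminf_finite) (use zero in \<open>auto simp: gr0_conv_Suc\<close>)
      finally show ?thesis by simp
    qed
    with nonconst show False by blast
  qed
  show "0 < D 2 0"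
  proof (rule ccontr)
    assume "\<not> 0 < D 2 0"
    with nonneg[of 0 2] b_pos have z: "D 2 0 = 0" by simp
    \<comment> \<open>If \<open>D 2 0 = 0\<close>, then \<open>D 2\<close> vanishes on the negative
      axis and \<open>D 0\<close> is affine there with positive slope; this is the point where it
      would equal -1.\<close>
    define u where "u = - (D 0 0 + 1) / D 1 0"
    have "0 \<le> D 0 0" using b_pos by (intro nonneg)
    then have u: "u < 0" using D1 by (simp add: u_def divide_less_0_iff)
    have "\<exists>t. u < t \<and> t < 0 \<and>
        D 0 u = (\<Sum>m<2. D m 0 / fact m * u ^ m) + D 2 t / fact 2 * u ^ 2"
      by (rule Maclaurin_minus) (use u b_pos in \<open>auto intro!: deriv\<close>)
    then obtain t where t: "t < 0"
      and eq: "D 0 u = (\<Sum>m<2. D m 0 / fact m * u ^ m) + D 2 t / fact 2 * u ^ 2" by blast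
    have "D 2 t \<le> D 2 0" "0 \<le> D 2 t" using t b_pos by (auto intro: mono nonneg)
    with eq z have "D 0 u = D 0 0 + D 1 0 * u" by (simp add: numeral_2_eq_2)
    also have "\<dots> = -1" using D1 by (simp add: u_def)
    finally show False using nonneg[of u 0] u b_pos by simp
  qed
qed

end

text \<open>Each differentiation of the reflected function contributes a factor -1, which absorbs
  the alternating signs.\<close>

lemma completely_monotone_imp_absolutely_monotone:
  assumes "completely_monotone \<phi>" "0 < b"
  shows "absolutely_monotone_below (\<lambda>k u. (-1) ^ k * (deriv ^^ k) \<phi> (b - u)) b"
proof
  fix u k assume u: "u < b"
  show "0 \<le> (-1) ^ k * (deriv ^^ k) \<phi> (b - u)"
    using assms u by (simp add: completely_monotone_def)
  have "(deriv ^^ k) \<phi> differentiable (at (b - u))"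
    using assms u by (simp add: completely_monotone_def)
  then have "((deriv ^^ k) \<phi> has_real_derivative (deriv ^^ Suc k) \<phi> (b - u)) (at (b - u))"
    by (simp add: DERIV_deriv_iff_real_differentiable)
  then have "((\<lambda>u. (deriv ^^ k) \<phi> (b - u)) has_real_derivative
      (deriv ^^ Suc k) \<phi> (b - u) * (-1)) (at u)"
    by (rule DERIV_chain2) (auto intro!: derivative_eq_intros)
  from DERIV_cmult[OF this, of "(-1) ^ k"]
  show "((\<lambda>u. (-1) ^ k * (deriv ^^ k) \<phi> (b - u)) has_real_derivative
      (-1) ^ Suc k * (deriv ^^ Suc k) \<phi> (b - u)) (at u)"
    by simp
qed (use assms in simp)

section \<open>The power series of the arcsine\<close>

text \<open>At \<open>2 * m\<close> this is the central binomial coefficient of \<open>2 * m\<close>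
  over \<open>m\<close>, divided by \<open>4 ^ m\<close>.\<close>

definition arcsin_deriv_coeff :: "nat \<Rightarrow> real" where
  "arcsin_deriv_coeff n = (if even n then pochhammer (1/2) (n div 2) / fact (n div 2) else 0)"

definition arcsin_coeff :: "nat \<Rightarrow> real" where
  "arcsin_coeff n = (if n = 0 then 0 else arcsin_deriv_coeff (n - 1) / real n)"

lemma arcsin_coeff_nonneg: "0 \<le> arcsin_coeff n"
  by (simp add: arcsin_coeff_def arcsin_deriv_coeff_def pochhammer_nonneg)

lemma arcsin_coeff_pos: "odd n \<Longrightarrow> 0 < arcsin_coeff n"
  by (auto simp: arcsin_coeff_def arcsin_deriv_coeff_def pochhammer_pos elim!: oddE)

text \<open>This is the binomial series with exponent -1/2 at \<open>- x\<^sup>2\<close>; the sign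
  of the generalized binomial coefficient cancels that of the power.\<close>

lemma arcsin_deriv_coeff_sums:
  assumes "\<bar>x\<bar> < 1"
  shows "(\<lambda>n. arcsin_deriv_coeff n * x ^ n) sums inverse (sqrt (1 - x\<^sup>2))"
proof -
  have x2: "x\<^sup>2 < 1" using assms by (simp add: abs_square_less_1)
  then have "(\<lambda>n. ((-1/2) gchoose n) * (- x\<^sup>2) ^ n) sums (1 + - x\<^sup>2) powr (-1/2)"
    by (intro gen_binomial_real) simp
  moreover have "(1 + - x\<^sup>2) powr (-1/2) = inverse (sqrt (1 - x\<^sup>2))"
    using x2 powr_minus[of "1 - x\<^sup>2" "1/2"] by (simp add: powr_half_sqrt)
  moreover have "((-1/2) gchoose n) * (- x\<^sup>2) ^ n = arcsin_deriv_coeff (2 * n) * x ^ (2 * n)" for n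
  proof -
    have "(- x\<^sup>2) ^ n = (-1) ^ n * x ^ (2 * n)"
      unfolding power_minus[of "x\<^sup>2"] by (simp add: power_mult)
    moreover have "(-1) ^ n * (-1) ^ n = (1::real)"
      by (simp flip: power_mult_distrib)
    ultimately show ?thesis
      by (simp add: arcsin_deriv_coeff_def gbinomial_pochhammer field_simps)
  qed
  ultimately have "(\<lambda>n. arcsin_deriv_coeff (2 * n) * x ^ (2 * n)) sums inverse (sqrt (1 - x\<^sup>2))"
    by simp
  then show ?thesis
    by (subst (asm) sums_mono_reindex[of "\<lambda>n. 2 * n"])
      (auto simp: strict_mono_def arcsin_deriv_coeff_def elim!: evenE)
qed

text \<open>The termwise integrated series and the arcsine have the same derivative on the open
  interval and agree at 0.\<close>

lemma arcsin_sums: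
  assumes x: "\<bar>x\<bar> < 1"
  shows "(\<lambda>n. arcsin_coeff n * x ^ n) sums arcsin x"
proof -
  define f where "f n = arcsin_deriv_coeff n / real (Suc n)" for n
  define g where "g x = (\<Sum>n. f n * x ^ Suc n)" for x
  have f: "f n * real (Suc n) * y ^ n = arcsin_deriv_coeff n * y ^ n" for n y
    by (simp add: f_def)
  have summable: "summable (\<lambda>n. f n * y ^ Suc n)" if "\<bar>y\<bar> < 1" for y
  proof (rule summable_comparison_test')
    show "summable (\<lambda>n. arcsin_deriv_coeff n * \<bar>y\<bar> ^ n)"
      using arcsin_deriv_coeff_sums[of "\<bar>y\<bar>"] that by (simp add: sums_iff)
    fix n
    have d: "0 \<le> arcsin_deriv_coeff n" by (simp add: arcsin_deriv_coeff_def pochhammer_nonneg)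
    have "norm (f n * y ^ Suc n) = f n * \<bar>y\<bar> ^ Suc n"
      using d by (simp add: f_def abs_mult power_abs)
    also have "\<dots> \<le> arcsin_deriv_coeff n * \<bar>y\<bar> ^ n"
    proof (rule mult_mono)
      show "f n \<le> arcsin_deriv_coeff n"
        using d by (simp add: f_def divide_le_eq mult_le_cancel_left1)
      show "\<bar>y\<bar> ^ Suc n \<le> \<bar>y\<bar> ^ n"
        using that by (intro power_decreasing) auto
    qed (use d in auto)
    finally show "norm (f n * y ^ Suc n) \<le> arcsin_deriv_coeff n * \<bar>y\<bar> ^ n" .
  qed
  have dg: "(g has_real_derivative inverse (sqrt (1 - y\<^sup>2))) (at y)" if "\<bar>y\<bar> < 1" for y
  proof -
    have "DERIV (\<lambda>x. \<Sum>n. f n * x ^ Suc n) y :> (\<Sum>n. f n * real (Suc n) * y ^ n)"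
      by (rule DERIV_power_series'[where R = 1])
        (use that arcsin_deriv_coeff_sums in \<open>auto simp: f sums_iff abs_less_iff simp del: of_nat_Suc\<close>)
    then show ?thesis
      using arcsin_deriv_coeff_sums[OF that] by (simp add: g_def[abs_def] f sums_iff del: of_nat_Suc)
  qed
  have "((\<lambda>y. g y - arcsin y) has_real_derivative 0) (at y)" if "y \<in> {-1<..<1}" for y
    using DERIV_diff[OF dg DERIV_arcsin, of y] that by auto
  then obtain c where c: "\<And>y. y \<in> {-1<..<1} \<Longrightarrow> g y - arcsin y = c"
    using has_field_derivative_zero_constant[of "{-1<..<1::real}" "\<lambda>y. g y - arcsin y"]
    by (metis at_within_open convex_real_interval(8) open_greaterThanLessThan)
  have "g 0 = 0" by (simp add: g_def)
  with c[of 0] c[of x] x have "g x = arcsin x" by (auto simp: abs_less_iff)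
  then have "(\<lambda>n. arcsin_coeff (Suc n) * x ^ Suc n) sums arcsin x"
    using summable[OF x] by (simp add: g_def f_def arcsin_coeff_def sums_iff)
  then show ?thesis
    by (subst (asm) sums_Suc_iff) (simp add: arcsin_coeff_def)
qed

section \<open>Positive semidefinite kernels on a finite set\<close>

definition quad_form :: "'b set \<Rightarrow> ('b \<Rightarrow> real) \<Rightarrow> ('b \<Rightarrow> 'b \<Rightarrow> real) \<Rightarrow> real" where
  "quad_form I c K = (\<Sum>i\<in>I. \<Sum>j\<in>I. c i * c j * K i j)"

definition psd_on :: "'b set \<Rightarrow> ('b \<Rightarrow> 'b \<Rightarrow> real) \<Rightarrow> bool" where
  "psd_on I K \<longleftrightarrow> (\<forall>c. 0 \<le> quad_form I c K)"

lemma psd_on_one: "psd_on I (\<lambda>i j. 1)"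
proof -
  have "quad_form I c (\<lambda>i j. 1) = (sum c I)\<^sup>2" for c
    by (simp add: quad_form_def power2_eq_square sum_product)
  then show ?thesis by (simp add: psd_on_def)
qed

text \<open>A Schur product theorem for Gram kernels: the form splits over the coordinates
  \<open>l\<close> into forms of \<open>K\<close> with weights \<open>c i * x i l\<close>.\<close>

lemma psd_on_gram_mult:
  assumes "psd_on I K" "finite L"
  shows "psd_on I (\<lambda>i j. (\<Sum>l\<in>L. x i l * x j l) * K i j)"
proof -
  have "quad_form I c (\<lambda>i j. (\<Sum>l\<in>L. x i l * x j l) * K i j)
      = (\<Sum>l\<in>L. quad_form I (\<lambda>i. c i * x i l) K)" for c
  proof -
    have "quad_form I c (\<lambda>i j. (\<Sum>l\<in>L. x i l * x j l) * K i j)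
        = (\<Sum>i\<in>I. \<Sum>j\<in>I. \<Sum>l\<in>L. c i * x i l * (c j * x j l) * K i j)"
      by (simp add: quad_form_def sum_distrib_left sum_distrib_right mult_ac)
    also have "\<dots> = (\<Sum>i\<in>I. \<Sum>l\<in>L. \<Sum>j\<in>I. c i * x i l * (c j * x j l) * K i j)"
      by (intro sum.cong refl sum.swap)
    also have "\<dots> = (\<Sum>l\<in>L. quad_form I (\<lambda>i. c i * x i l) K)"
      unfolding quad_form_def by (rule sum.swap)
    finally show ?thesis .
  qed
  with assms show ?thesis by (simp add: psd_on_def sum_nonneg)
qed

text \<open>After scaling by \<open>t < 1\<close> the form is a convergent series of nonnegative
  terms, so it dominates its \<open>k\<close>-th term; then \<open>t\<close> tends to 1. The factor
  \<open>K\<close> allows series to be substituted one factor at a time.\<close>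

lemma quad_form_power_series_ge:
  fixes s :: "'b \<Rightarrow> 'b \<Rightarrow> real"
  assumes a: "\<And>n. 0 \<le> a n"
    and sums: "\<And>x. \<bar>x\<bar> < R \<Longrightarrow> (\<lambda>n. a n * x ^ n) sums f x"
    and cont: "continuous_on {-R..R} f"
    and s: "\<And>i j. i \<in> I \<Longrightarrow> j \<in> I \<Longrightarrow> \<bar>s i j\<bar> \<le> R"
    and R: "0 < R"
    and psd: "\<And>n. psd_on I (\<lambda>i j. s i j ^ n * K i j)"
  shows "a k * quad_form I c (\<lambda>i j. s i j ^ k * K i j) \<le> quad_form I c (\<lambda>i j. f (s i j) * K i j)"
proof -
  define q where "q n = quad_form I c (\<lambda>i j. s i j ^ n * K i j)" for n
  have q: "0 \<le> q n" for n using psd by (simp add: q_def psd_on_def)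
  define G where "G t = quad_form I c (\<lambda>i j. f (t * s i j) * K i j) - a k * t ^ k * q k" for t :: real
  have ts: "\<bar>t * s i j\<bar> \<le> t * R" if "0 \<le> t" "i \<in> I" "j \<in> I" for t i j
    using that s by (simp add: abs_mult mult_left_mono)
  have "0 \<le> G t" if t: "t \<in> {0<..<1}" for t
  proof -
    have "t * R < R" using t R by simp
    then have "(\<lambda>n. a n * (t * s i j) ^ n) sums f (t * s i j)" if "i \<in> I" "j \<in> I" for i j
      using ts[of t i j] that t by (intro sums) auto
    then have "(\<lambda>n. \<Sum>i\<in>I. \<Sum>j\<in>I. c i * c j * (a n * (t * s i j) ^ n * K i j)) sums
        quad_form I c (\<lambda>i j. f (t * s i j) * K i j)"
      unfolding quad_form_def by (intro sums_sum sums_mult sums_mult2)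
    also have "(\<lambda>n. \<Sum>i\<in>I. \<Sum>j\<in>I. c i * c j * (a n * (t * s i j) ^ n * K i j))
        = (\<lambda>n. a n * t ^ n * q n)"
      by (simp add: q_def quad_form_def sum_distrib_left power_mult_distrib mult_ac)
    finally have S: "(\<lambda>n. a n * t ^ n * q n) sums quad_form I c (\<lambda>i j. f (t * s i j) * K i j)" .
    have "(\<Sum>n\<in>{k}. a n * t ^ n * q n) \<le> (\<Sum>n. a n * t ^ n * q n)"
      by (rule sum_le_suminf) (use S a q t in \<open>auto simp: sums_iff\<close>)
    with S show ?thesis by (simp add: G_def sums_iff)
  qed
  moreover have "continuous_on {0..1} G"
    unfolding G_def quad_form_def
  proof (intro continuous_intros)
    fix i j assume ij: "i \<in> I" "j \<in> I"
    show "continuous_on {0..1} (\<lambda>t. f (t * s i j))"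
    proof (rule continuous_on_compose2[OF cont])
      show "(\<lambda>t. t * s i j) ` {0..1} \<subseteq> {-R..R}"
      proof (rule image_subsetI)
        fix t :: real assume t: "t \<in> {0..1}"
        then have "t * R \<le> R" using R by simp
        with ts[of t, OF _ ij] t have "\<bar>t * s i j\<bar> \<le> R" by auto
        then show "t * s i j \<in> {-R..R}" by (simp add: abs_le_iff)
      qed
    qed (intro continuous_intros)
  qed
  ultimately have "0 \<le> G 1"
    using continuous_ge_on_closure[of "{0<..<1::real}" G 1 0] by simp
  then show ?thesis by (simp add: G_def q_def)
qed

section \<open>Spherical kernels\<close>

locale sphere_points =
  fixes I :: "'b set" and x :: "'b \<Rightarrow> nat \<Rightarrow> real" and d :: nat
  assumes fin: "finite I" and sphere: "x ` I \<subseteq> unit_sphere d" and inj: "inj_on x I"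
begin

definition dot :: "'b \<Rightarrow> 'b \<Rightarrow> real" where "dot i j = (\<Sum>l\<le>d. x i l * x j l)"

lemma dot_self: "i \<in> I \<Longrightarrow> dot i i = 1"
  using sphere by (auto simp: dot_def nsphere power2_eq_square)

text \<open>Nonnegativity of these sums yields the Cauchy-Schwarz bound, and vanishing of the first
  forces equal points.\<close>

lemma dot_sum_diff:
  assumes "i \<in> I" "j \<in> I"
  shows "(\<Sum>l\<le>d. (x i l - x j l)\<^sup>2) = 2 - 2 * dot i j"
    and "(\<Sum>l\<le>d. (x i l + x j l)\<^sup>2) = 2 + 2 * dot i j"
proof -
  have "(\<Sum>l\<le>d. (x i l)\<^sup>2) = 1" "(\<Sum>l\<le>d. (x j l)\<^sup>2) = 1"
    using assms sphere by (auto simp: nsphere)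
  then show "(\<Sum>l\<le>d. (x i l - x j l)\<^sup>2) = 2 - 2 * dot i j"
    and "(\<Sum>l\<le>d. (x i l + x j l)\<^sup>2) = 2 + 2 * dot i j"
    by (simp_all add: power2_diff power2_sum sum.distrib sum_subtractf dot_def
        mult.assoc flip: sum_distrib_left)
qed

lemma abs_dot_le: "i \<in> I \<Longrightarrow> j \<in> I \<Longrightarrow> \<bar>dot i j\<bar> \<le> 1"
  using dot_sum_diff[of i j] sum_nonneg[of "{..d}" "\<lambda>l. (x i l - x j l)\<^sup>2"]
    sum_nonneg[of "{..d}" "\<lambda>l. (x i l + x j l)\<^sup>2"] by (simp add: abs_le_iff)

lemma dot_less_1:
  assumes "i \<in> I" "j \<in> I" "i \<noteq> j"
  shows "dot i j < 1"
proof -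
  have "dot i j \<noteq> 1"
  proof
    assume "dot i j = 1"
    then have "(\<Sum>l\<le>d. (x i l - x j l)\<^sup>2) = 0" using dot_sum_diff assms by simp
    then have "x i l = x j l" if "l \<le> d" for l
      using that by (simp add: sum_nonneg_eq_0_iff)
    moreover have "x i l = x j l" if "\<not> l \<le> d" for l
    proof -
      have "x i \<in> unit_sphere d" "x j \<in> unit_sphere d" using assms sphere by auto
      with that show ?thesis by (simp add: nsphere)
    qed
    ultimately have "x i = x j" by blast
    with inj assms show False by (auto dest: inj_onD)
  qed
  with abs_dot_le[of i j] assms show ?thesis by auto
qed

lemma psd_on_dot_power_mult: "psd_on I K \<Longrightarrow> psd_on I (\<lambda>i j. dot i j ^ n * K i j)"
proof (induction n)
  case (Suc n)
  from psd_on_gram_mult[OF Suc.IH[OF Suc.prems] finite_atMost[of d], of x] show ?case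
    by (simp add: dot_def mult.assoc)
qed simp

lemma quad_form_arcsin_ge:
  assumes "psd_on I K"
  shows "arcsin_coeff n * quad_form I c (\<lambda>i j. dot i j ^ n * K i j)
    \<le> quad_form I c (\<lambda>i j. arcsin (dot i j) * K i j)"
  by (rule quad_form_power_series_ge[where R = 1])
    (use assms in \<open>auto intro: arcsin_coeff_nonneg arcsin_sums continuous_on_arcsin'
      abs_dot_le psd_on_dot_power_mult\<close>)

lemma psd_on_arcsin_power: "psd_on I (\<lambda>i j. arcsin (dot i j) ^ n)"
proof (induction n)
  case 0
  show ?case by (simp add: psd_on_one)
next
  case (Suc n)
  \<comment> \<open>Since \<open>arcsin_coeff 0 = 0\<close>, the lower bound at index 0 is plain
    nonnegativity.\<close>
  from quad_form_arcsin_ge[OF this, of 0] show ?case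
    by (simp add: psd_on_def arcsin_coeff_def)
qed

text \<open>As \<open>s\<^sup>2\<^sup>n (1 + s)\<close> tends to 0 for \<open>-1 \<le> s < 1\<close>, only the diagonal survives in the limit.\<close>
lemma quad_form_dot_power_eq_0_imp:
  assumes zero: "\<And>n. n \<ge> 1 \<Longrightarrow> quad_form I c (\<lambda>i j. dot i j ^ n) = 0"
    and i: "i \<in> I"
  shows "c i = 0"
proof -
  \<comment> \<open>The factor \<open>1 + s\<close> removes antipodal pairs, where
    \<open>s ^ (2 * n)\<close> stays 1, and equals 2 on the diagonal.\<close>
  let ?p = "\<lambda>n s::real. s ^ (2 * n) * (1 + s)"
  have lim: "(\<lambda>n. ?p n s) \<longlonglongrightarrow> 0" if "\<bar>s\<bar> \<le> 1" "s \<noteq> 1" for s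
  proof (cases "s = -1")
    case False
    with that have "s\<^sup>2 < 1" by (simp add: abs_square_less_1)
    then have "(\<lambda>n. (s\<^sup>2) ^ n) \<longlonglongrightarrow> 0" by (intro LIMSEQ_realpow_zero) auto
    then show ?thesis by (intro tendsto_mult_left_zero) (simp add: power_mult)
  qed simp
  have "(\<lambda>n. ?p n (dot i j)) \<longlonglongrightarrow> (if i = j then 2 else 0)" if "i \<in> I" "j \<in> I" for i j
    using lim[of "dot i j"] that dot_self dot_less_1[of i j] abs_dot_le[of i j] by auto
  then have "(\<lambda>n. quad_form I c (\<lambda>i j. ?p n (dot i j)))
      \<longlonglongrightarrow> quad_form I c (\<lambda>i j. if i = j then 2 else 0)"
    unfolding quad_form_def by (intro tendsto_sum tendsto_mult tendsto_const)
  moreover have "quad_form I c (\<lambda>i j. ?p n (dot i j))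
      = quad_form I c (\<lambda>i j. dot i j ^ (2 * n)) + quad_form I c (\<lambda>i j. dot i j ^ Suc (2 * n))" for n
    by (simp add: quad_form_def sum.distrib algebra_simps)
  then have "quad_form I c (\<lambda>i j. ?p n (dot i j)) = 0" if "n \<ge> 1" for n
    using that zero[of "2 * n"] zero[of "Suc (2 * n)"] by simp
  then have "(\<lambda>n. quad_form I c (\<lambda>i j. ?p n (dot i j))) \<longlonglongrightarrow> 0"
    by (intro tendsto_eventually eventually_sequentiallyI[of 1]) auto
  ultimately have "quad_form I c (\<lambda>i j. if i = j then 2 else 0) = 0"
    by (rule LIMSEQ_unique)
  moreover have "quad_form I c (\<lambda>i j. if i = j then 2 else 0) = 2 * (\<Sum>i\<in>I. (c i)\<^sup>2)"
    using fin by (simp add: quad_form_def if_distrib sum_distrib_left power2_eq_square mult_ac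
        cong: if_cong)
  ultimately show ?thesis using fin i by (simp add: sum_nonneg_eq_0_iff)
qed

lemma quad_form_arcsin_kernel:
  assumes a: "\<And>n. 0 \<le> a n" and a12: "0 < a 1" "0 < a 2"
    and sums: "\<And>u. \<bar>u\<bar> < pi / 2 \<Longrightarrow> (\<lambda>n. a n * u ^ n) sums f u"
    and cont: "continuous_on {- (pi / 2)..pi / 2} f"
  shows "0 \<le> quad_form I c (\<lambda>i j. f (arcsin (dot i j)))"
    and "i \<in> I \<Longrightarrow> c i \<noteq> 0 \<Longrightarrow> 0 < quad_form I c (\<lambda>i j. f (arcsin (dot i j)))"
proof -
  have "\<bar>arcsin (dot i j)\<bar> \<le> pi / 2" if "i \<in> I" "j \<in> I" for i j
    using abs_dot_le[OF that] arcsin_bounded[of "dot i j"] by (auto simp: abs_le_iff)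
  then have ge: "a k * quad_form I c (\<lambda>i j. arcsin (dot i j) ^ k)
      \<le> quad_form I c (\<lambda>i j. f (arcsin (dot i j)))" for k
    using quad_form_power_series_ge[where R = "pi / 2" and a = a and f = f and I = I
        and s = "\<lambda>i j. arcsin (dot i j)" and K = "\<lambda>i j. 1" and k = k and c = c]
      a sums cont psd_on_arcsin_power by simp
  have psd: "0 \<le> quad_form I c (\<lambda>i j. arcsin (dot i j) ^ k)" for k
    using psd_on_arcsin_power by (simp add: psd_on_def)
  show nonneg: "0 \<le> quad_form I c (\<lambda>i j. f (arcsin (dot i j)))"
    using mult_nonneg_nonneg[OF a psd] ge order_trans by blast
  show "0 < quad_form I c (\<lambda>i j. f (arcsin (dot i j)))" if i: "i \<in> I" "c i \<noteq> 0"
  proof (rule ccontr)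
    assume "\<not> ?thesis"
    with nonneg have z: "quad_form I c (\<lambda>i j. f (arcsin (dot i j))) = 0" by simp
    have arcsin_0: "quad_form I c (\<lambda>i j. arcsin (dot i j) ^ k) = 0" if "0 < a k" for k
      using ge[of k] psd[of k] z that by (simp add: mult_le_0_iff)
    have dot_ge: "0 \<le> quad_form I c (\<lambda>i j. dot i j ^ n)" for n
      using psd_on_dot_power_mult[OF psd_on_one] by (simp add: psd_on_def)
    have "quad_form I c (\<lambda>i j. dot i j ^ n) = 0" if "n \<ge> 1" for n
    proof (cases "odd n")
      case True
      have "arcsin_coeff n * quad_form I c (\<lambda>i j. dot i j ^ n) \<le> 0"
        using quad_form_arcsin_ge[OF psd_on_one, of n c] arcsin_0[OF a12(1)] by simp
      with arcsin_coeff_pos[OF True] dot_ge[of n] show ?thesis by (simp add: mult_le_0_iff)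
    next
      case False
      \<comment> \<open>The arcsine has only odd powers, so even \<open>n\<close> needs its square:
        one factor is bounded below through its linear term, the other through its term of odd
        degree \<open>m\<close>.\<close>
      with that obtain m where m: "n = Suc m" "odd m" by (cases n) auto
      have psd1: "psd_on I (\<lambda>i j. dot i j)"
        using psd_on_dot_power_mult[OF psd_on_one, of 1] by simp
      have "arcsin_coeff m * quad_form I c (\<lambda>i j. dot i j ^ n)
          \<le> quad_form I c (\<lambda>i j. dot i j * arcsin (dot i j))"
        using quad_form_arcsin_ge[OF psd1, of m c] m by (simp add: mult_ac)
      moreover have "arcsin_coeff 1 * quad_form I c (\<lambda>i j. dot i j * arcsin (dot i j))
          \<le> quad_form I c (\<lambda>i j. arcsin (dot i j) ^ 2)"
        using quad_form_arcsin_ge[OF psd_on_arcsin_power[of 1], of 1 c]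
        by (simp add: power2_eq_square)
      then have "quad_form I c (\<lambda>i j. dot i j * arcsin (dot i j)) \<le> 0"
        using arcsin_0[OF a12(2)] arcsin_coeff_pos[of 1] by (simp add: mult_le_0_iff)
      ultimately have "arcsin_coeff m * quad_form I c (\<lambda>i j. dot i j ^ n) \<le> 0" by linarith
      with arcsin_coeff_pos[OF m(2)] dot_ge[of n] show ?thesis by (simp add: mult_le_0_iff)
    qed
    from quad_form_dot_power_eq_0_imp[OF this i(1)] i(2) show False by blast
  qed
qed

end

theorem theorem7:
  fixes \<phi> :: "real \<Rightarrow> real"
  assumes "completely_monotone \<phi>"
    and "\<phi> 0 = 1"
    and "\<not> \<phi> constant_on {0..}"
  shows "restrict \<phi> {0..pi} \<in> Psi_plus_infinity"
proof -
  define F where "F u = \<phi> (pi / 2 - u)" for u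
  have cont: "continuous_on {0..} \<phi>" using assms(1) by (simp add: completely_monotone_def)
  \<comment> \<open>Reflection at \<open>pi / 2\<close> matches
    \<open>arccos s = pi / 2 - arcsin s\<close>, and the series then converges on the whole open
    range of the arcsine.\<close>
  interpret absolutely_monotone_below "\<lambda>k u. (-1) ^ k * (deriv ^^ k) \<phi> (pi / 2 - u)" "pi / 2"
    using assms(1) by (rule completely_monotone_imp_absolutely_monotone) simp
  define a where "a n = (-1) ^ n * (deriv ^^ n) \<phi> (pi / 2) / fact n" for n
  have a: "0 \<le> a n" for n
    using nonneg[of 0 n] by (simp add: a_def)
  \<comment> \<open>The locale sees only \<open>t > 0\<close>; constancy there would extend to 0 by
    continuity.\<close>
  have nonconst: "\<not> (\<forall>u<pi / 2. \<phi> (pi / 2 - u) = \<phi> (pi / 2))"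
  proof
    assume *: "\<forall>u<pi / 2. \<phi> (pi / 2 - u) = \<phi> (pi / 2)"
    have "\<phi> t = \<phi> (pi / 2)" if "t \<in> {0<..}" for t
      using *[rule_format, of "pi / 2 - t"] that by simp
    then have "\<phi> constant_on {0<..}" unfolding constant_on_def by blast
    from constant_on_closureI[OF this] cont have "\<phi> constant_on {0..}" by simp
    with assms(3) show False by blast
  qed
  have a12: "0 < a 1" "0 < a 2"
    using deriv_0_pos nonconst by (auto simp: a_def)
  have sums: "(\<lambda>n. a n * u ^ n) sums F u" if "\<bar>u\<bar> < pi / 2" for u
    using power_series[OF that] by (simp add: a_def F_def)
  \<comment> \<open>The endpoint \<open>u = pi / 2\<close> corresponds to angle 0, so continuity of
    \<open>\<phi>\<close> at 0 enters here.\<close>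
  have contF: "continuous_on {- (pi / 2)..pi / 2} F"
    unfolding F_def by (rule continuous_on_compose2[OF cont]) (auto intro!: continuous_intros)
  have "strictly_positive_definite_on (unit_sphere d)
      (\<lambda>x y. restrict \<phi> {0..pi} (great_circle_dist d x y))" for d
    unfolding strictly_positive_definite_on_def
  proof (intro allI impI)
    fix n :: nat and x :: "nat \<Rightarrow> nat \<Rightarrow> real" and c :: "nat \<Rightarrow> real"
    assume x: "x ` {1..n} \<subseteq> unit_sphere d" "inj_on x {1..n}"
    interpret sphere_points "{1..n}" x d by unfold_locales (use x in auto)
    have "restrict \<phi> {0..pi} (great_circle_dist d (x i) (x j)) = F (arcsin (dot i j))"
      if "i \<in> {1..n}" "j \<in> {1..n}" for i j
    proof -
      have "great_circle_dist d (x i) (x j) = arccos (dot i j)"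
        by (simp add: great_circle_dist_def dot_def)
      with abs_dot_le[OF that] arccos_bounded[of "dot i j"] arccos_arcsin_eq[of "dot i j"]
      show ?thesis by (simp add: F_def abs_le_iff)
    qed
    then have "(\<Sum>i=1..n. \<Sum>j=1..n. c i * c j * restrict \<phi> {0..pi} (great_circle_dist d (x i) (x j)))
        = quad_form {1..n} c (\<lambda>i j. F (arcsin (dot i j)))"
      unfolding quad_form_def by (intro sum.cong) auto
    with quad_form_arcsin_kernel[OF a a12 sums contF, where c = c]
    show "(\<Sum>i=1..n. \<Sum>j=1..n. c i * c j * restrict \<phi> {0..pi} (great_circle_dist d (x i) (x j))) \<ge> 0 \<and>
      ((\<exists>i\<in>{1..n}. c i \<noteq> 0) \<longrightarrow>
        (\<Sum>i=1..n. \<Sum>j=1..n. c i * c j * restrict \<phi> {0..pi} (great_circle_dist d (x i) (x j))) > 0)"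
      by auto
  qed
  moreover have "continuous_on {0..pi} (restrict \<phi> {0..pi})"
    using continuous_on_subset[OF cont, of "{0..pi}"]
    by (subst continuous_on_cong[OF refl, of _ _ \<phi>]) auto
  ultimately show ?thesis
    using assms(2) by (simp add: Psi_plus_infinity_def Psi_plus_def)
qed

end
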